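(* Let $(H,m,1,\Delta,\varepsilon,t,\phi)$ be a biFrobenius algebra over a field $\Bbbk$ with antipode $\mathcal S$, modular element $a\in H$ and modular function $\alpha\in H^*$. Then for all $x\in H$, $$\mathcal S^4(x)=a\,(\alpha^{-1}\rightharpoonup x\leftharpoonup\alpha)\,a^{-1},$$ that is, $\mathcal S^4(x)=\sum \alpha(x_1)\,\alpha^{-1}(x_3)\,a x_2 a^{-1}$. In particular, if $\alpha=\varepsilon$ and $a=1$, then $\mathcal S^4=\operatorname{id}$.
   Context: Let $\Bbbk$ be a field, $(H,m,1)$ an associative unital $\Bbbk$-algebra and $(H,\Delta,\varepsilon)$ a coassociative counital $\Bbbk$-coalgebra on the same vector space (no compatibility between $m$ and $\Delta$ is assumed beyond what is stated below). Sweedler notation is used: $\Delta(x)=\sum x_1\otimes x_2$. Actions, for $x,y\in H$, $\lambda\in H^*$: $(x\rightharpoonup\lambda)(y)=\lambda(yx)$, $(\lambda\leftharpoonup x)(y)=\lambda(xy)$, $x\leftharpoonup\lambda=\sum\lambda(x_1)x_2$, $\lambda\rightharpoonup x=\sum x_1\lambda(x_2)$. BiFrobenius algebra: let $\phi\in H^*$ and $t\in H$. The tuple $(H,m,1,\Delta,\varepsilon,t,\phi)$ is a biFrobenius algebra if: (1) $H^*=\phi\leftharpoonup H$ (Frobenius algebra) and $H=t\leftharpoonup H^*$ (coFrobenius coalgebra); in particular $H$ is finite dimensional; (2) $1$ is a group-like element ($\Delta(1)=1\otimes 1$, $\varepsilon(1)=1$) and $\varepsilon$ is an algebra homomorphism;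 (3) $t\leftharpoonup\phi=1$ and $\phi\leftharpoonup t=\varepsilon$; then $tx=\varepsilon(x)t$ and $\phi(x)1=\sum\phi(x_1)x_2$ for all $x\in H$, and $\phi(t)=1$; (4) the map $\mathcal S:H\to H$, $\mathcal S(x)=\sum\phi(t_1x)t_2$ (the antipode), is an antiautomorphism of algebras and of coalgebras. The modular function is $\alpha=t\rightharpoonup\phi\in H^*$, and the modular element is $a=\phi\rightharpoonup t=\sum t_1\phi(t_2)\in H$. In a biFrobenius algebra, $\alpha$ is an algebra morphism $H\to\Bbbk$, $a$ is group-like and invertible with $a^{-1}=\mathcal S(a)$, and $\alpha^{-1}=\alpha\circ\mathcal S$ is the inverse of $\alpha$ for the convolution product in $H^*$. *)

theory Defs
  imports "HOL-Library.Poly_Mapping" "HOL.Vector_Spaces"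
begin

section \<open>Free vector spaces\<close>

text \<open>The free vector space on a type of basis elements consists of the finitely supported
  functions into the field.\<close>

definition fscale :: "'k::field \<Rightarrow> ('b \<Rightarrow>\<^sub>0 'k) \<Rightarrow> ('b \<Rightarrow>\<^sub>0 'k)"
  where "fscale c p = Poly_Mapping.map ((*) c) p"

lemma lookup_fscale: "Poly_Mapping.lookup (fscale c p) b = c * Poly_Mapping.lookup p b"
  by (simp add: fscale_def map.rep_eq when_def)

global_interpretation free: vector_space fscale
  by unfold_locales (auto intro!: poly_mapping_eqI simp: lookup_fscale lookup_add algebra_simps)

abbreviation basis_vec :: "'b \<Rightarrow> ('b \<Rightarrow>\<^sub>0 'k::field)"
  where "basis_vec b \<equiv> Poly_Mapping.single b 1"

text \<open>The linear extension of a map on the basis to a vector space with scalar multiplication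
  \<open>s\<close>.\<close>

definition lin_ext ::
    "('k::field \<Rightarrow> 'w \<Rightarrow> 'w::ab_group_add) \<Rightarrow> ('b \<Rightarrow> 'w) \<Rightarrow> ('b \<Rightarrow>\<^sub>0 'k) \<Rightarrow> 'w"
  where "lin_ext s f p = (\<Sum>b\<in>Poly_Mapping.keys p. s (Poly_Mapping.lookup p b) (f b))"


section \<open>Tensor powers of a vector space\<close>

text \<open>The second and third tensor powers of the space \<open>V\<close> given by \<open>scale\<close> are the quotients of
  the free vector spaces on \<open>V \<times> V\<close> and \<open>V \<times> V \<times> V\<close> by the subspaces spanned by the
  multilinearity relations; their elements are cosets.\<close>

context vector_space
begin

definition dual :: "('b \<Rightarrow> 'a) set"
  where "dual = {f. Vector_Spaces.linear scale (*) f}"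

definition relations2 :: "('b \<times> 'b \<Rightarrow>\<^sub>0 'a) set"
  where "relations2 =
    {basis_vec (x + x', y) - basis_vec (x, y) - basis_vec (x', y) | x x' y. True} \<union>
    {basis_vec (x, y + y') - basis_vec (x, y) - basis_vec (x, y') | x y y'. True} \<union>
    {basis_vec (scale c x, y) - fscale c (basis_vec (x, y)) | c x y. True} \<union>
    {basis_vec (x, scale c y) - fscale c (basis_vec (x, y)) | c x y. True}"

definition relations3 :: "('b \<times> 'b \<times> 'b \<Rightarrow>\<^sub>0 'a) set"
  where "relations3 =
    {basis_vec (x + x', y, z) - basis_vec (x, y, z) - basis_vec (x', y, z) | x x' y z. True} \<union>
    {basis_vec (x, y + y', z) - basis_vec (x, y, z) - basis_vec (x, y', z) | x y y' z. True} \<union>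
    {basis_vec (x, y, z + z') - basis_vec (x, y, z) - basis_vec (x, y, z') | x y z z'. True} \<union>
    {basis_vec (scale c x, y, z) - fscale c (basis_vec (x, y, z)) | c x y z. True} \<union>
    {basis_vec (x, scale c y, z) - fscale c (basis_vec (x, y, z)) | c x y z. True} \<union>
    {basis_vec (x, y, scale c z) - fscale c (basis_vec (x, y, z)) | c x y z. True}"

definition coset2 :: "('b \<times> 'b \<Rightarrow>\<^sub>0 'a) \<Rightarrow> ('b \<times> 'b \<Rightarrow>\<^sub>0 'a) set"
  where "coset2 p = {q. q - p \<in> free.span relations2}"

definition coset3 :: "('b \<times> 'b \<times> 'b \<Rightarrow>\<^sub>0 'a) \<Rightarrow> ('b \<times> 'b \<times> 'b \<Rightarrow>\<^sub>0 'a) set"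
  where "coset3 p = {q. q - p \<in> free.span relations3}"

definition tensor2 :: "('b \<times> 'b \<Rightarrow>\<^sub>0 'a) set set"
  where "tensor2 = range coset2"

text \<open>The linear map on the tensor square (cube) induced by a bilinear (trilinear) map \<open>f\<close> into
  a space with scalar multiplication \<open>s\<close>, evaluated at a coset. With \<open>A = \<Delta>(x)\<close> this is the
  Sweedler sum of \<open>f x\<^sub>1 x\<^sub>2\<close>. The representative chosen does not matter.\<close>

definition lift2 ::
    "('a \<Rightarrow> 'w \<Rightarrow> 'w::ab_group_add) \<Rightarrow> ('b \<Rightarrow> 'b \<Rightarrow> 'w) \<Rightarrow> ('b \<times> 'b \<Rightarrow>\<^sub>0 'a) set \<Rightarrow> 'w"
  where "lift2 s f A = lin_ext s (\<lambda>(x, y). f x y) (SOME p. p \<in> A)"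

definition lift3 ::
    "('a \<Rightarrow> 'w \<Rightarrow> 'w::ab_group_add) \<Rightarrow> ('b \<Rightarrow> 'b \<Rightarrow> 'b \<Rightarrow> 'w) \<Rightarrow>
      ('b \<times> 'b \<times> 'b \<Rightarrow>\<^sub>0 'a) set \<Rightarrow> 'w"
  where "lift3 s f A = lin_ext s (\<lambda>(x, y, z). f x y z) (SOME p. p \<in> A)"

end

lemma lin_ext_superset:
  assumes "vector_space s" "finite B" "Poly_Mapping.keys p \<subseteq> B"
  shows "lin_ext s f p = (\<Sum>b\<in>B. s (Poly_Mapping.lookup p b) (f b))"
proof -
  interpret vector_space s by fact
  show ?thesis
    unfolding lin_ext_def using assms(2,3)
    by (intro sum.mono_neutral_left) (auto simp: in_keys_iff)
qed

lemma linear_lin_ext: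
  fixes s :: "'k::field \<Rightarrow> 'w \<Rightarrow> 'w::ab_group_add" and f :: "'b \<Rightarrow> 'w"
  assumes s: "vector_space s"
  shows "Vector_Spaces.linear fscale s (lin_ext s f)"
proof -
  interpret s: vector_space s by fact
  show ?thesis
  proof unfold_locales
    fix p q :: "'b \<Rightarrow>\<^sub>0 'k"
    let ?B = "Poly_Mapping.keys p \<union> Poly_Mapping.keys q"
    have "Poly_Mapping.keys (p + q) \<subseteq> ?B" by (rule keys_add)
    then show "lin_ext s f (p + q) = lin_ext s f p + lin_ext s f q"
      by (simp add: lin_ext_superset[OF s, of ?B] lookup_add s.scale_left_distrib sum.distrib)
  next
    fix c :: 'k and p :: "'b \<Rightarrow>\<^sub>0 'k"
    have "Poly_Mapping.keys (fscale c p) \<subseteq> Poly_Mapping.keys p"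
      by (auto simp: in_keys_iff lookup_fscale)
    then show "lin_ext s f (fscale c p) = s c (lin_ext s f p)"
      by (simp add: lin_ext_superset[OF s, of "Poly_Mapping.keys p"] lookup_fscale s.scale_sum_right)
  qed
qed

lemma lin_ext_basis_vec:
  assumes "vector_space s"
  shows "lin_ext s f (basis_vec b) = f b"
proof -
  interpret s: vector_space s by fact
  show ?thesis by (simp add: lin_ext_def)
qed

context vector_space
begin

lemma lin_ext_relations2:
  assumes s: "vector_space s"
    and l: "\<And>y. Vector_Spaces.linear scale s (\<lambda>x. f x y)"
    and r: "\<And>x. Vector_Spaces.linear scale s (\<lambda>y. f x y)"
    and p: "p \<in> free.span relations2"
  shows "lin_ext s (\<lambda>(x, y). f x y) p = 0"
proof -
  interpret L: Vector_Spaces.linear fscale s "lin_ext s (\<lambda>(x, y). f x y)"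
    by (rule linear_lin_ext[OF s])
  interpret l: Vector_Spaces.linear scale s "\<lambda>x. f x y" for y by (rule l)
  interpret r: Vector_Spaces.linear scale s "\<lambda>y. f x y" for x by (rule r)
  show ?thesis
    using p
  proof (rule L.eq_0_on_span[rotated])
    fix q assume "q \<in> relations2"
    then show "lin_ext s (\<lambda>(x, y). f x y) q = 0"
      unfolding relations2_def
      by (auto simp: L.diff L.scale lin_ext_basis_vec[OF s] l.add l.scale r.add r.scale)
  qed
qed

lemma lift2_eq_lin_ext:
  assumes s: "vector_space s"
    and l: "\<And>y. Vector_Spaces.linear scale s (\<lambda>x. f x y)"
    and r: "\<And>x. Vector_Spaces.linear scale s (\<lambda>y. f x y)"
    and A: "A \<in> tensor2" "p \<in> A"
  shows "lift2 s f A = lin_ext s (\<lambda>(x, y). f x y) p"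
proof -
  interpret L: Vector_Spaces.linear fscale s "lin_ext s (\<lambda>(x, y). f x y)"
    by (rule linear_lin_ext[OF s])
  obtain p0 where A0: "A = coset2 p0" using A by (auto simp: tensor2_def)
  define q where "q = (SOME p. p \<in> A)"
  have "q \<in> A" unfolding q_def using A(2) by (rule someI)
  with A(2) A0 have "(q - p0) - (p - p0) \<in> free.span relations2"
    unfolding coset2_def by (blast intro: free.span_diff)
  then have "lin_ext s (\<lambda>(x, y). f x y) (q - p) = 0"
    by (intro lin_ext_relations2[OF s l r]) auto
  then show ?thesis by (simp add: L.diff lift2_def q_def)
qed

end


section \<open>Algebras and coalgebras\<close>

locale unital_algebra = vector_space scale
  for scale :: "'k::field \<Rightarrow> 'h::ring_1 \<Rightarrow> 'h" +
  assumes scale_mult_left: "scale c x * y = scale c (x * y)"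
    and scale_mult_right: "x * scale c y = scale c (x * y)"

text \<open>Data of a linear map \<open>\<Delta>\<close> into the tensor square and of a linear form \<open>\<epsilon>\<close>.\<close>

locale precoalgebra = vector_space scale
  for scale :: "'k::field \<Rightarrow> 'h::ab_group_add \<Rightarrow> 'h" +
  fixes \<Delta> :: "'h \<Rightarrow> ('h \<times> 'h \<Rightarrow>\<^sub>0 'k) set"
    and \<epsilon> :: "'h \<Rightarrow> 'k"
  assumes comult_tensor: "\<Delta> x \<in> tensor2"
    and comult_add: "\<lbrakk>p \<in> \<Delta> x; q \<in> \<Delta> y\<rbrakk> \<Longrightarrow> p + q \<in> \<Delta> (x + y)"
    and comult_scale: "p \<in> \<Delta> x \<Longrightarrow> fscale c p \<in> \<Delta> (scale c x)"
    and counit_dual: "\<epsilon> \<in> dual"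
begin

definition comult_rep :: "'h \<Rightarrow> ('h \<times> 'h \<Rightarrow>\<^sub>0 'k)"
  where "comult_rep x = (SOME p. p \<in> \<Delta> x)"

text \<open>\<open>(\<Delta> \<otimes> id)(\<Delta>(x))\<close> and \<open>(id \<otimes> \<Delta>)(\<Delta>(x))\<close> in the tensor cube,
  computed from representatives; the resulting cosets do not depend on the choice.\<close>

definition comult_left :: "'h \<Rightarrow> ('h \<times> 'h \<times> 'h \<Rightarrow>\<^sub>0 'k) set"
  where "comult_left x = coset3 (lin_ext fscale
    (\<lambda>(u, v). lin_ext fscale (\<lambda>(u1, u2). basis_vec (u1, u2, v)) (comult_rep u)) (comult_rep x))"

definition comult_right :: "'h \<Rightarrow> ('h \<times> 'h \<times> 'h \<Rightarrow>\<^sub>0 'k) set"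
  where "comult_right x = coset3 (lin_ext fscale
    (\<lambda>(u, v). lin_ext fscale (\<lambda>(v1, v2). basis_vec (u, v1, v2)) (comult_rep v)) (comult_rep x))"

text \<open>The actions of the dual: \<open>right_act x f\<close> is the sum of \<open>f(x\<^sub>1) x\<^sub>2\<close>, written
  \<open>x \<leftharpoonup> f\<close>, and \<open>left_act f x\<close> is the sum of \<open>x\<^sub>1 f(x\<^sub>2)\<close>, written \<open>f \<rightharpoonup> x\<close>.\<close>

definition right_act :: "'h \<Rightarrow> ('h \<Rightarrow> 'k) \<Rightarrow> 'h"
  where "right_act x f = lift2 scale (\<lambda>x1 x2. scale (f x1) x2) (\<Delta> x)"

definition left_act :: "('h \<Rightarrow> 'k) \<Rightarrow> 'h \<Rightarrow> 'h"
  where "left_act f x = lift2 scale (\<lambda>x1 x2. scale (f x2) x1) (\<Delta> x)"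

definition convolution :: "('h \<Rightarrow> 'k) \<Rightarrow> ('h \<Rightarrow> 'k) \<Rightarrow> 'h \<Rightarrow> 'k"
  where "convolution f g x = lift2 (*) (\<lambda>x1 x2. f x1 * g x2) (\<Delta> x)"

definition convolution_inverse :: "('h \<Rightarrow> 'k) \<Rightarrow> 'h \<Rightarrow> 'k"
  where "convolution_inverse f =
    (THE g. g \<in> dual \<and> convolution f g = \<epsilon> \<and> convolution g f = \<epsilon>)"

definition group_like :: "'h \<Rightarrow> bool"
  where "group_like g \<longleftrightarrow> \<Delta> g = coset2 (basis_vec (g, g)) \<and> \<epsilon> g = 1"

text \<open>Antiautomorphisms of the coalgebra: \<open>\<Delta>(S(x))\<close> is the sum of \<open>S(x\<^sub>2) \<otimes> S(x\<^sub>1)\<close>.\<close>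

definition coalgebra_antiautomorphism :: "('h \<Rightarrow> 'h) \<Rightarrow> bool"
  where "coalgebra_antiautomorphism S \<longleftrightarrow>
    Vector_Spaces.linear scale scale S \<and> bij S \<and>
    (\<forall>x. \<Delta> (S x) = coset2 (lin_ext fscale (\<lambda>(u, v). basis_vec (S v, S u)) (comult_rep x))) \<and>
    (\<forall>x. \<epsilon> (S x) = \<epsilon> x)"

end

locale counital_coalgebra = precoalgebra +
  assumes coassoc: "comult_left x = comult_right x"
    and counit_left: "right_act x \<epsilon> = x"
    and counit_right: "left_act \<epsilon> x = x"

definition algebra_antiautomorphism ::
    "('k::field \<Rightarrow> 'h::ring_1 \<Rightarrow> 'h) \<Rightarrow> ('h \<Rightarrow> 'h) \<Rightarrow> bool"
  where "algebra_antiautomorphism scale S \<longleftrightarrow>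
    Vector_Spaces.linear scale scale S \<and> bij S \<and> (\<forall>x y. S (x * y) = S y * S x) \<and> S 1 = 1"

text \<open>The actions on the dual of an algebra: \<open>x \<rightharpoonup> f\<close> and \<open>f \<leftharpoonup> x\<close>.\<close>

definition dual_left_act :: "'h::ring_1 \<Rightarrow> ('h \<Rightarrow> 'k) \<Rightarrow> 'h \<Rightarrow> 'k"
  where "dual_left_act x f = (\<lambda>y. f (y * x))"

definition dual_right_act :: "('h::ring_1 \<Rightarrow> 'k) \<Rightarrow> 'h \<Rightarrow> 'h \<Rightarrow> 'k"
  where "dual_right_act f x = (\<lambda>y. f (x * y))"

definition mult_inverse :: "'h::ring_1 \<Rightarrow> 'h"
  where "mult_inverse x = (THE y. x * y = 1 \<and> y * x = 1)"


section \<open>BiFrobenius algebras\<close>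

locale prebifrobenius_algebra =
  unital_algebra scale + counital_coalgebra scale \<Delta> \<epsilon>
  for scale :: "'k::field \<Rightarrow> 'h::ring_1 \<Rightarrow> 'h"
    and \<Delta> :: "'h \<Rightarrow> ('h \<times> 'h \<Rightarrow>\<^sub>0 'k) set"
    and \<epsilon> :: "'h \<Rightarrow> 'k" +
  fixes t :: 'h
    and \<phi> :: "'h \<Rightarrow> 'k"
  assumes phi_dual: "\<phi> \<in> dual"
begin

text \<open>\<open>S(x)\<close> is the sum of \<open>\<phi>(t\<^sub>1 x) t\<^sub>2\<close>.\<close>

definition antipode :: "'h \<Rightarrow> 'h"
  where "antipode x = lift2 scale (\<lambda>t1 t2. scale (\<phi> (t1 * x)) t2) (\<Delta> t)"

definition modular_function :: "'h \<Rightarrow> 'k"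
  where "modular_function = dual_left_act t \<phi>"

definition modular_element :: 'h
  where "modular_element = left_act \<phi> t"

end

locale bifrobenius_algebra = prebifrobenius_algebra +
  assumes frobenius: "dual = range (dual_right_act \<phi>)"
    and cofrobenius: "UNIV = right_act t ` dual"
    and one_group_like: "group_like 1"
    and counit_mult: "\<epsilon> (x * y) = \<epsilon> x * \<epsilon> y"
    and counit_one: "\<epsilon> 1 = 1"
    and t_phi: "right_act t \<phi> = 1"
    and phi_t: "dual_right_act \<phi> t = \<epsilon>"
    and antipode_algebra: "algebra_antiautomorphism scale antipode"
    and antipode_coalgebra: "coalgebra_antiautomorphism antipode"

end

(* All computations take place in the convolution algebra H*, which acts on H from both sides; the
   form phi separates points, so identities in H are tested on H*. Since the antipode S is
   x |-> t <- (x -> phi), inverting it gives dual bases t_1, S^-1(t_2) of phi. They yield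
   phi o S = phi <- a and, dually, S(t) = t <- alpha, whence the Nakayama automorphism nu of phi is
   nu(x) = S^-2(x <- alpha). The Nakayama automorphism of phi o S = phi <- a is computed in two
   ways: as a conjugate of nu by S, and as nu twisted by a. Comparing the two is Radford's
   formula. *)

theory Submission
  imports Defs
begin

section \<open>Sweedler sums\<close>

lemma vector_space_mult: "vector_space ((*) :: 'k::field \<Rightarrow> 'k \<Rightarrow> 'k)"
  by unfold_locales (simp_all add: algebra_simps)

lemma inverse_element_unique:
  fixes x :: "'a::monoid_mult"
  assumes "z * x = 1" "x * y = 1"
  shows "z = y"
  using assms by (metis mult.assoc mult_1_left mult_1_right)

lemma linear_lin_ext_comp:
  assumes "Vector_Spaces.linear s s' L"
  shows "L (lin_ext s f p) = lin_ext s' (\<lambda>b. L (f b)) p"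
proof -
  interpret Vector_Spaces.linear s s' L by fact
  show ?thesis by (simp add: lin_ext_def sum scale)
qed

context vector_space
begin

lemma dualI:
  assumes "\<And>x y. f (x + y) = f x + f y" "\<And>c x. f (scale c x) = c * f x"
  shows "f \<in> dual"
proof -
  interpret k: vector_space "(*) :: 'a \<Rightarrow> 'a \<Rightarrow> 'a" by (rule vector_space_mult)
  show ?thesis unfolding dual_def by (simp, unfold_locales) (use assms in auto)
qed

lemma dual_linear: "f \<in> dual \<Longrightarrow> Vector_Spaces.linear scale (*) f"
  by (simp add: dual_def)

lemma dual_add: "f \<in> dual \<Longrightarrow> f (x + y) = f x + f y"
  and dual_scale: "f \<in> dual \<Longrightarrow> f (scale c x) = c * f x"
  by (auto dest!: dual_linear
      simp: module_hom.add module_hom.scale Vector_Spaces.linear_def)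

lemma dual_comp: "\<lbrakk>f \<in> dual; Vector_Spaces.linear scale scale T\<rbrakk> \<Longrightarrow> (\<lambda>x. f (T x)) \<in> dual"
proof -
  assume f: "f \<in> dual" and "Vector_Spaces.linear scale scale T"
  then interpret Vector_Spaces.linear scale scale T by simp
  show ?thesis by (rule dualI) (simp_all add: add scale dual_add[OF f] dual_scale[OF f])
qed

lemma dual_times: "f \<in> dual \<Longrightarrow> (\<lambda>x. c * f x) \<in> dual"
  by (rule dualI) (simp_all add: dual_add dual_scale algebra_simps)

lemma linearI:
  assumes "\<And>x y. f (x + y) = f x + f y" "\<And>c x. f (scale c x) = scale c (f x)"
  shows "Vector_Spaces.linear scale scale f"
  by unfold_locales (use assms in auto)

lemma lin_ext_relations3:
  assumes s: "vector_space s"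
    and "\<And>y z. Vector_Spaces.linear scale s (\<lambda>x. f x y z)"
    and "\<And>x z. Vector_Spaces.linear scale s (\<lambda>y. f x y z)"
    and "\<And>x y. Vector_Spaces.linear scale s (\<lambda>z. f x y z)"
    and p: "p \<in> free.span relations3"
  shows "lin_ext s (\<lambda>(x, y, z). f x y z) p = 0"
proof -
  interpret L: Vector_Spaces.linear fscale s "lin_ext s (\<lambda>(x, y, z). f x y z)"
    by (rule linear_lin_ext[OF s])
  interpret l: Vector_Spaces.linear scale s "\<lambda>x. f x y z" for y z by fact
  interpret m: Vector_Spaces.linear scale s "\<lambda>y. f x y z" for x z by fact
  interpret r: Vector_Spaces.linear scale s "\<lambda>z. f x y z" for x y by fact
  show ?thesis
    using p
  proof (rule L.eq_0_on_span[rotated])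
    fix q assume "q \<in> relations3"
    then show "lin_ext s (\<lambda>(x, y, z). f x y z) q = 0"
      unfolding relations3_def
      by (auto simp: L.diff L.scale lin_ext_basis_vec[OF s] l.add l.scale m.add m.scale
          r.add r.scale)
  qed
qed

text \<open>The representative picked by \<open>SOME\<close> differs from \<open>p\<close> by an
  element of \<open>free.span relations3\<close>, on which the linear extension of a trilinear map
  vanishes.\<close>

lemma lift3_coset3:
  assumes s: "vector_space s"
    and "\<And>y z. Vector_Spaces.linear scale s (\<lambda>x. f x y z)"
    and "\<And>x z. Vector_Spaces.linear scale s (\<lambda>y. f x y z)"
    and "\<And>x y. Vector_Spaces.linear scale s (\<lambda>z. f x y z)"
  shows "lift3 s f (coset3 p) = lin_ext s (\<lambda>(x, y, z). f x y z) p"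
proof -
  interpret L: Vector_Spaces.linear fscale s "lin_ext s (\<lambda>(x, y, z). f x y z)"
    by (rule linear_lin_ext[OF s])
  have "p \<in> coset3 p" by (simp add: coset3_def free.span_zero)
  then have "(SOME q. q \<in> coset3 p) \<in> coset3 p" by (rule someI)
  then have "lin_ext s (\<lambda>(x, y, z). f x y z) ((SOME q. q \<in> coset3 p) - p) = 0"
    by (intro lin_ext_relations3 assms) (simp add: coset3_def)
  then show ?thesis by (simp add: L.diff lift3_def)
qed

lemma dual_lift3:
  assumes "f \<in> dual"
  shows "f (lift3 scale g A) = lift3 (*) (\<lambda>x y z. f (g x y z)) A"
  unfolding lift3_def linear_lin_ext_comp[OF dual_linear[OF assms]]
  by (simp add: case_prod_unfold)

end

section \<open>The convolution product on the dual\<close>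

context precoalgebra
begin

lemma comult_rep: "comult_rep x \<in> \<Delta> x"
proof -
  obtain p where "\<Delta> x = coset2 p" using comult_tensor by (auto simp: tensor2_def)
  then have "p \<in> \<Delta> x" by (simp add: coset2_def free.span_zero)
  then show ?thesis unfolding comult_rep_def by (rule someI)
qed

lemma lift2_comult: "lift2 s f (\<Delta> x) = lin_ext s (\<lambda>(u, v). f u v) (comult_rep x)"
  by (simp add: lift2_def comult_rep_def)

text \<open>\<open>comult_rep\<close> need not be additive, so linearity of convolution is read off
  from other representatives, such as \<open>comult_rep x + comult_rep y\<close>.\<close>

lemma convolution_eq_lin_ext:
  assumes "f \<in> dual" "g \<in> dual" "p \<in> \<Delta> x"
  shows "convolution f g x = lin_ext (*) (\<lambda>(u, v). f u * g v) p"
  unfolding convolution_def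
  by (intro lift2_eq_lin_ext vector_space_mult comult_tensor assms(3); rule dual_linear, rule dualI)
    (simp_all add: assms dual_add dual_scale algebra_simps)

lemma convolution_dual:
  assumes "f \<in> dual" "g \<in> dual"
  shows "convolution f g \<in> dual"
proof (rule dualI)
  interpret L: Vector_Spaces.linear fscale "(*)" "lin_ext (*) (\<lambda>(u, v). f u * g v)"
    by (rule linear_lin_ext[OF vector_space_mult])
  show "convolution f g (x + y) = convolution f g x + convolution f g y" for x y
    using assms comult_rep[of x] comult_rep[of y]
    by (simp add: convolution_eq_lin_ext[of _ _ "comult_rep x + comult_rep y"] comult_add
        convolution_eq_lin_ext[of _ _ "comult_rep x" x] convolution_eq_lin_ext[of _ _ "comult_rep y" y] L.add)
  show "convolution f g (scale c x) = c * convolution f g x" for c x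
    using assms comult_rep[of x]
    by (simp add: convolution_eq_lin_ext[of _ _ "fscale c (comult_rep x)"] comult_scale
        convolution_eq_lin_ext[of _ _ "comult_rep x" x] L.scale)
qed

lemma apply_right_act: "g \<in> dual \<Longrightarrow> g (right_act x f) = convolution f g x"
  unfolding right_act_def convolution_def lift2_comult
  by (simp add: linear_lin_ext_comp[OF dual_linear] case_prod_unfold dual_scale)

lemma apply_left_act: "g \<in> dual \<Longrightarrow> g (left_act f x) = convolution g f x"
  unfolding left_act_def convolution_def lift2_comult
  by (simp add: linear_lin_ext_comp[OF dual_linear] case_prod_unfold dual_scale mult.commute)

lemma right_act_add: "right_act x (\<lambda>z. f z + g z) = right_act x f + right_act x g"
  unfolding right_act_def lift2_comult lin_ext_def
  by (simp add: case_prod_unfold scale_left_distrib scale_right_distrib sum.distrib)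

lemma right_act_scale: "right_act x (\<lambda>z. c * f z) = scale c (right_act x f)"
  unfolding right_act_def lift2_comult lin_ext_def
  by (simp add: case_prod_unfold scale_sum_right mult.left_commute)

lemma group_like_convolution:
  assumes "group_like g" "f \<in> dual" "h \<in> dual"
  shows "convolution f h g = f g * h g"
proof -
  have "basis_vec (g, g) \<in> \<Delta> g"
    using assms(1) by (simp add: group_like_def coset2_def free.span_zero)
  with assms show ?thesis
    by (simp add: convolution_eq_lin_ext lin_ext_basis_vec[OF vector_space_mult])
qed

text \<open>Flipping the tensor factors of \<open>\<Delta> x\<close> amounts to reversing a
  convolution product that is pulled back along \<open>S\<close>.\<close>

lemma antiautomorphism_convolution:
  assumes S: "coalgebra_antiautomorphism S" and "f \<in> dual" "g \<in> dual"
  shows "convolution f g (S x) = convolution (\<lambda>z. g (S z)) (\<lambda>z. f (S z)) x"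
proof -
  let ?p = "lin_ext fscale (\<lambda>(u, v). basis_vec (S v, S u)) (comult_rep x)"
  have "?p \<in> \<Delta> (S x)"
    using S by (simp add: coalgebra_antiautomorphism_def coset2_def free.span_zero)
  then have "convolution f g (S x) = lin_ext (*) (\<lambda>(u, v). f u * g v) ?p"
    using assms(2,3) by (rule convolution_eq_lin_ext[rotated 2])
  also have "\<dots> = lin_ext (*) (\<lambda>(u, v). f (S v) * g (S u)) (comult_rep x)"
    by (simp add: linear_lin_ext_comp[OF linear_lin_ext[OF vector_space_mult]]
        case_prod_unfold lin_ext_basis_vec[OF vector_space_mult])
  finally show ?thesis
    by (simp add: convolution_def lift2_comult mult.commute)
qed

end

section \<open>Associativity, unit and inverses for convolution\<close>

context counital_coalgebra
begin

lemma convolution_counit_left: "f \<in> dual \<Longrightarrow> convolution \<epsilon> f = f"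
  by (rule ext) (simp flip: apply_right_act add: counit_left)

lemma convolution_counit_right: "f \<in> dual \<Longrightarrow> convolution f \<epsilon> = f"
  by (rule ext) (simp flip: apply_left_act add: counit_right)

text \<open>Tested on three forms, the two iterated coproducts become the two bracketings of a
  triple convolution; coassociativity thereby yields \<open>convolution_assoc\<close>.\<close>

lemma
  assumes "f \<in> dual" "g \<in> dual" "h \<in> dual"
  shows lift3_comult_left:
      "lift3 (*) (\<lambda>u v w. f u * g v * h w) (comult_left x) = convolution (convolution f g) h x"
    and lift3_comult_right:
      "lift3 (*) (\<lambda>u v w. f u * g v * h w) (comult_right x) = convolution f (convolution g h) x"
proof -
  let ?F = "\<lambda>(u, v, w). f u * g v * h w"
  have lin: "lift3 (*) (\<lambda>u v w. f u * g v * h w) (coset3 p) = lin_ext (*) ?F p" for p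
    by (rule lift3_coset3[OF vector_space_mult]; rule dual_linear, rule dualI)
      (simp_all add: assms dual_add dual_scale algebra_simps)
  show "lift3 (*) (\<lambda>u v w. f u * g v * h w) (comult_left x) = convolution (convolution f g) h x"
    unfolding comult_left_def lin
    by (simp add: linear_lin_ext_comp[OF linear_lin_ext[OF vector_space_mult]]
        case_prod_unfold lin_ext_basis_vec[OF vector_space_mult] convolution_def lift2_comult)
      (simp add: lin_ext_def sum_distrib_right mult.assoc)
  show "lift3 (*) (\<lambda>u v w. f u * g v * h w) (comult_right x) = convolution f (convolution g h) x"
    unfolding comult_right_def lin
    by (simp add: linear_lin_ext_comp[OF linear_lin_ext[OF vector_space_mult]]
        case_prod_unfold lin_ext_basis_vec[OF vector_space_mult] convolution_def lift2_comult)
      (simp add: lin_ext_def sum_distrib_left mult_ac)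
qed

lemma convolution_assoc:
  assumes "f \<in> dual" "g \<in> dual" "h \<in> dual"
  shows "convolution (convolution f g) h = convolution f (convolution g h)"
  using lift3_comult_left[OF assms] lift3_comult_right[OF assms] by (simp add: coassoc fun_eq_iff)

lemma convolution_inverse_unique:
  assumes "f \<in> dual" "g \<in> dual" "h \<in> dual" "convolution g f = \<epsilon>" "convolution f h = \<epsilon>"
  shows "g = h"
  by (metis assms convolution_assoc convolution_counit_left convolution_counit_right)

lemma convolution_inverse_eq:
  assumes "f \<in> dual" "g \<in> dual" "convolution f g = \<epsilon>" "convolution g f = \<epsilon>"
  shows "convolution_inverse f = g"
  unfolding convolution_inverse_def
  by (rule the_equality) (use assms convolution_inverse_unique in blast)+

end


section \<open>Consequences of the axioms of biFrobenius algebras\<close>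

context bifrobenius_algebra
begin

notation convolution (infixl "\<star>" 70)

abbreviation S :: "'b \<Rightarrow> 'b" where "S \<equiv> antipode"
abbreviation Si :: "'b \<Rightarrow> 'b" where "Si \<equiv> inv antipode"
abbreviation a :: 'b where "a \<equiv> modular_element"
abbreviation \<alpha> :: "'b \<Rightarrow> 'a" where "\<alpha> \<equiv> modular_function"

lemma dual_mult_left: "f \<in> dual \<Longrightarrow> (\<lambda>y. f (x * y)) \<in> dual"
  by (rule dualI) (simp_all add: dual_add dual_scale distrib_left scale_mult_right)

lemma dual_mult_right: "f \<in> dual \<Longrightarrow> (\<lambda>y. f (y * x)) \<in> dual"
  by (rule dualI) (simp_all add: dual_add dual_scale distrib_right scale_mult_left)

lemma linear_S: "Vector_Spaces.linear scale scale S"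
  and bij_S: "bij S"
  and S_mult: "S (x * y) = S y * S x"
  and S_1: "S 1 = 1"
  and counit_S: "\<epsilon> (S x) = \<epsilon> x"
  using antipode_algebra antipode_coalgebra
  by (auto simp: algebra_antiautomorphism_def coalgebra_antiautomorphism_def)

lemma S_Si: "S (Si x) = x" and Si_S: "Si (S x) = x"
  using bij_S by (simp_all add: bij_is_surj surj_f_inv_f bij_is_inj)

lemma S_eqD: "S x = S y \<Longrightarrow> x = y"
  by (metis Si_S)

lemma S_add: "S (x + y) = S x + S y" and S_scale: "S (scale c x) = scale c (S x)"
proof -
  interpret Vector_Spaces.linear scale scale S by (rule linear_S)
  show "S (x + y) = S x + S y" "S (scale c x) = scale c (S x)" by (rule add scale)+
qed

lemma Si_scale: "Si (scale c x) = scale c (Si x)"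
  by (rule S_eqD) (simp add: S_Si S_scale)

lemma linear_Si: "Vector_Spaces.linear scale scale Si"
  by (rule linearI; rule S_eqD) (simp_all add: S_Si S_scale S_add)

lemma Si_mult: "Si (x * y) = Si y * Si x"
  by (rule S_eqD) (simp add: S_Si S_mult)

lemma Si_1: "Si 1 = 1"
  by (metis S_1 Si_S)

lemma counit_Si: "\<epsilon> (Si x) = \<epsilon> x"
  by (metis S_Si counit_S)

lemmas dual_S = dual_comp[OF _ linear_S]
lemmas dual_Si = dual_comp[OF _ linear_Si]

lemma phi_left_dual: "(\<lambda>y. \<phi> (x * y)) \<in> dual"
  and phi_right_dual: "(\<lambda>y. \<phi> (y * x)) \<in> dual"
  by (simp_all add: dual_mult_left dual_mult_right phi_dual)

lemma alpha_eq: "\<alpha> x = \<phi> (x * t)"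
  by (simp add: modular_function_def dual_left_act_def)

lemma alpha_dual: "\<alpha> \<in> dual"
  using phi_right_dual[of t] by (simp add: alpha_eq[abs_def])

lemmas dual_intros = phi_dual phi_left_dual phi_right_dual alpha_dual counit_dual
  dual_S dual_Si convolution_dual

lemma convolution_S: "f \<in> dual \<Longrightarrow> g \<in> dual \<Longrightarrow>
    (f \<star> g) (S x) = ((\<lambda>z. g (S z)) \<star> (\<lambda>z. f (S z))) x"
  by (rule antiautomorphism_convolution[OF antipode_coalgebra])

lemma S_eq: "S x = right_act t (\<lambda>y. \<phi> (y * x))"
  by (simp add: antipode_def right_act_def)

lemma dual_phi_left: "f \<in> dual \<Longrightarrow> \<exists>x. f = (\<lambda>y. \<phi> (x * y))"
  using frobenius by (auto simp: dual_right_act_def)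

lemma phi_t_mult: "\<phi> (t * x) = \<epsilon> x"
  using phi_t by (simp add: dual_right_act_def fun_eq_iff)

lemma phi_t_eq_1: "\<phi> t = 1"
  using phi_t_mult[of 1] by (simp add: counit_one)

subsection \<open>Nondegeneracy\<close>

text \<open>\<open>S x\<close> depends on \<open>x\<close> only through the form
  \<open>\<phi> (_ * x)\<close>, and \<open>S\<close> is injective.\<close>

lemma nondegenerate_right:
  assumes "\<And>y. \<phi> (y * x) = \<phi> (y * x')"
  shows "x = x'"
  by (rule S_eqD) (simp add: S_eq assms)

lemma dual_separates:
  assumes "\<And>f. f \<in> dual \<Longrightarrow> f x = f y"
  shows "x = y"
  by (rule nondegenerate_right) (rule assms[OF phi_left_dual])

text \<open>All elements \<open>right_act t f\<close> are combinations of the second tensor factors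
  of one finite representative of \<open>\<Delta> t\<close>, and they exhaust the space by
  \<open>cofrobenius\<close>.\<close>

lemma finite_spanning: "\<exists>B. finite B \<and> span B = UNIV"
proof (intro exI conjI)
  let ?B = "snd ` Poly_Mapping.keys (comult_rep t)"
  show "finite ?B" by simp
  have "right_act t f \<in> span ?B" for f
    unfolding right_act_def lift2_comult lin_ext_def
    by (intro span_sum) (simp add: case_prod_unfold span_scale span_base)
  moreover have "\<exists>f. x = right_act t f" for x using cofrobenius by blast
  ultimately show "span ?B = UNIV" by (metis UNIV_eq_I)
qed

lemma inj_endomorphism_of_surj:
  assumes "Vector_Spaces.linear scale scale T" "surj T"
  shows "inj T"
proof -
  obtain C where C: "finite C" "span C = UNIV" using finite_spanning by blast
  obtain B where B: "B \<subseteq> C" "independent B" "C \<subseteq> span B"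
    using maximal_independent_subset[of C] by blast
  from B(3) C(2) have "span B = UNIV"
    by (metis span_mono span_span top.extremum_uniqueI)
  then interpret finite_dimensional_vector_space scale B
    using B C(1) by unfold_locales (auto intro: finite_subset)
  interpret pair: finite_dimensional_vector_space_pair scale B scale B ..
  show ?thesis by (rule pair.linear_surjective_imp_injective[OF assms refl])
qed

text \<open>By the two Frobenius axioms, \<open>x \<mapsto> t \<leftharpoonup> (\<phi> \<leftharpoonup> x)\<close> is a surjective endomorphism of a finite dimensional
  space; hence both of its factors are injective.\<close>

lemma inj_right_act_phi: "inj (\<lambda>x. right_act t (\<lambda>y. \<phi> (x * y)))"
proof (rule inj_endomorphism_of_surj)
  show "Vector_Spaces.linear scale scale (\<lambda>x. right_act t (\<lambda>y. \<phi> (x * y)))"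
    by (rule linearI)
      (simp_all add: distrib_right scale_mult_left dual_add[OF phi_dual] dual_scale[OF phi_dual]
        right_act_add right_act_scale)
  have "\<exists>x. z = right_act t (\<lambda>y. \<phi> (x * y))" for z
  proof -
    obtain f where "f \<in> dual" "z = right_act t f" using cofrobenius by blast
    then show ?thesis using dual_phi_left by blast
  qed
  then show "surj (\<lambda>x. right_act t (\<lambda>y. \<phi> (x * y)))" by (simp add: surj_def)
qed

lemma nondegenerate_left:
  assumes "\<And>y. \<phi> (x * y) = \<phi> (x' * y)"
  shows "x = x'"
  using inj_right_act_phi by (rule injD) (simp add: assms)

text \<open>Every form is some \<open>\<phi> (x * _)\<close>, so this is the injectivity of
  \<open>inj_right_act_phi\<close> in terms of forms. It serves to prove equations between forms by
  letting them act on \<open>t\<close>.\<close>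

lemma right_act_t_inject:
  assumes "f \<in> dual" "g \<in> dual" "right_act t f = right_act t g"
  shows "f = g"
proof -
  obtain x y where xy: "f = (\<lambda>z. \<phi> (x * z))" "g = (\<lambda>z. \<phi> (y * z))"
    using assms dual_phi_left by blast
  with assms(3) injD[OF inj_right_act_phi] have "x = y" by blast
  with xy show ?thesis by simp
qed

lemma dual_phi_right:
  assumes "f \<in> dual"
  shows "\<exists>x. f = (\<lambda>y. \<phi> (y * x))"
proof (intro exI right_act_t_inject)
  \<comment> \<open>The witness is forced: \<open>\<phi> (_ * x)\<close> acts on \<open>t\<close> as
    \<open>S x\<close>, so \<open>x\<close> has to be \<open>Si (right_act t f)\<close>.\<close>
  show "right_act t f = right_act t (\<lambda>y. \<phi> (y * Si (right_act t f)))"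
    unfolding S_eq[symmetric] by (simp add: S_Si)
qed (auto intro: dual_intros assms)

section \<open>The space as a bimodule over its convolution algebra\<close>

lemma right_act_right_act:
  assumes "f \<in> dual" "g \<in> dual"
  shows "right_act (right_act x f) g = right_act x (f \<star> g)"
  by (rule dual_separates)
    (simp add: apply_right_act assms dual_intros convolution_assoc)

lemma left_act_left_act:
  assumes "f \<in> dual" "g \<in> dual"
  shows "left_act f (left_act g x) = left_act (f \<star> g) x"
  by (rule dual_separates)
    (simp add: apply_left_act assms dual_intros convolution_assoc)

lemma left_act_right_act:
  assumes "f \<in> dual" "g \<in> dual"
  shows "left_act f (right_act x g) = right_act (left_act f x) g"
  by (rule dual_separates)
    (simp add: apply_left_act apply_right_act assms dual_intros convolution_assoc)

text \<open>\<open>S\<close> reverses the coproduct and so exchanges the two actions, transporting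
  the form along \<open>Si\<close>.\<close>

lemma S_right_act:
  assumes "f \<in> dual"
  shows "S (right_act x f) = left_act (\<lambda>z. f (Si z)) (S x)"
  by (rule dual_separates)
    (simp add: apply_left_act convolution_S dual_intros assms Si_S
      apply_right_act[of "\<lambda>z. _ (S z)"])

lemma S_left_act:
  assumes "f \<in> dual"
  shows "S (left_act f x) = right_act (S x) (\<lambda>z. f (Si z))"
  by (rule dual_separates)
    (simp add: apply_right_act convolution_S dual_intros assms Si_S
      apply_left_act[of "\<lambda>z. _ (S z)"])

subsection \<open>The modular element and the modular function\<close>

text \<open>As \<open>t\<close> is a right integral, \<open>\<phi> (x * t * y)\<close> equals
  \<open>\<phi> (x * t) * \<epsilon> y\<close>, whose first factor is \<open>\<alpha> x\<close>;
  nondegeneracy removes \<open>\<phi>\<close>.\<close>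

lemma mult_t: "x * t = scale (\<alpha> x) t"
proof (rule nondegenerate_left)
  fix y
  have ty: "t * y = scale (\<epsilon> y) t"
    by (rule nondegenerate_left) (simp add: mult.assoc phi_t_mult counit_mult scale_mult_left
        dual_scale[OF phi_dual])
  show "\<phi> (x * t * y) = \<phi> (scale (\<alpha> x) t * y)"
    by (simp add: mult.assoc ty scale_mult_right scale_mult_left dual_scale[OF phi_dual] alpha_eq
        phi_t_eq_1)
qed

lemma alpha_mult: "\<alpha> (x * y) = \<alpha> x * \<alpha> y"
proof -
  have "x * y * t = scale (\<alpha> x * \<alpha> y) t"
    by (subst mult.assoc) (simp add: mult_t scale_mult_right mult.commute)
  then show ?thesis
    by (simp add: alpha_eq[of "x * y"] dual_scale[OF phi_dual] phi_t_eq_1)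
qed

lemma alpha_1: "\<alpha> 1 = 1"
  by (simp add: alpha_eq phi_t_eq_1)

lemma apply_a: "f \<in> dual \<Longrightarrow> f a = (f \<star> \<phi>) t"
  by (simp add: modular_element_def apply_left_act)

text \<open>The dual counterpart of \<open>mult_t\<close>: \<open>\<phi>\<close> is an eigenvector
  for left convolution, and evaluation at \<open>a\<close> gives the eigenvalues.\<close>

lemma convolution_phi:
  assumes f: "f \<in> dual"
  shows "f \<star> \<phi> = (\<lambda>x. f a * \<phi> x)"
proof (rule ext)
  fix x
  \<comment> \<open>The action of \<open>\<phi>\<close> takes \<open>t\<close> to the group-like
    element 1, on which \<open>g\<close> acts as the scalar \<open>g 1\<close>.\<close>
  have phi_g: "\<phi> \<star> g = (\<lambda>x. g 1 * \<phi> x)" if "g \<in> dual" for g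
  proof (rule right_act_t_inject)
    have "right_act t (\<phi> \<star> g) = right_act 1 g"
      using that by (simp add: right_act_right_act[symmetric] phi_dual t_phi)
    also have "\<dots> = scale (g 1) 1"
      by (rule dual_separates)
        (simp add: apply_right_act that group_like_convolution[OF one_group_like] dual_scale)
    also have "\<dots> = right_act t (\<lambda>x. g 1 * \<phi> x)"
      by (simp add: right_act_scale t_phi)
    finally show "right_act t (\<phi> \<star> g) = right_act t (\<lambda>x. g 1 * \<phi> x)" .
  qed (intro dual_intros that dual_times)+
  \<comment> \<open>Testing the action of \<open>f \<star> \<phi>\<close> on \<open>t\<close>
    against \<open>g\<close> brings in \<open>\<phi> \<star> g\<close>, so \<open>phi_g\<close>
    shows that the result is a multiple of 1, which is \<open>right_act t \<phi>\<close>.\<close>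
  have "f \<star> \<phi> = (\<lambda>x. (f \<star> \<phi>) t * \<phi> x)"
  proof (rule right_act_t_inject)
    show "right_act t (f \<star> \<phi>) = right_act t (\<lambda>x. (f \<star> \<phi>) t * \<phi> x)"
    proof (rule dual_separates)
      fix g assume g: "g \<in> dual"
      have "(f \<star> \<phi> \<star> g) t = (f \<star> (\<lambda>x. g 1 * \<phi> x)) t"
        using f g by (simp add: convolution_assoc phi_dual phi_g)
      also have "\<dots> = g 1 * (f \<star> \<phi>) t"
        by (simp add: convolution_def lift2_comult lin_ext_def case_prod_unfold sum_distrib_left
            mult_ac)
      also have "\<dots> = g (right_act t (\<lambda>x. (f \<star> \<phi>) t * \<phi> x))"
        by (subst right_act_scale) (simp add: t_phi dual_scale[OF g])
      finally show "g (right_act t (f \<star> \<phi>)) = g (right_act t (\<lambda>x. (f \<star> \<phi>) t * \<phi> x))"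
        using g by (simp only: apply_right_act)
    qed
  qed (intro dual_intros f dual_times)+
  from fun_cong[OF this, of x] show "(f \<star> \<phi>) x = f a * \<phi> x"
    by (simp only: apply_a[OF f])
qed

lemma left_act_phi: "left_act \<phi> x = scale (\<phi> x) a"
  by (rule dual_separates) (simp add: apply_left_act convolution_phi dual_scale mult.commute)

text \<open>This is the group-likeness of \<open>a\<close>, tested on forms: eigenvalues of left
  convolution on \<open>\<phi>\<close> are multiplicative by associativity.\<close>

lemma convolution_a:
  assumes "f \<in> dual" "g \<in> dual"
  shows "(f \<star> g) a = f a * g a"
proof -
  have "(f \<star> g) a = (f \<star> (g \<star> \<phi>)) t"
    using assms by (simp add: apply_a dual_intros convolution_assoc)
  also have "\<dots> = (f \<star> (\<lambda>x. g a * \<phi> x)) t" using assms by (simp add: convolution_phi)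
  also have "\<dots> = g a * (f \<star> \<phi>) t"
    by (simp add: convolution_def lift2_comult lin_ext_def case_prod_unfold sum_distrib_left mult_ac)
  finally show ?thesis using assms by (simp add: apply_a mult.commute)
qed

lemma counit_a: "\<epsilon> a = 1"
  by (simp add: apply_a counit_dual convolution_counit_left phi_dual phi_t_eq_1)

lemma right_act_a: "f \<in> dual \<Longrightarrow> right_act a f = scale (f a) a"
  by (rule dual_separates) (simp add: apply_right_act convolution_a dual_scale)

text \<open>\<open>t\<^sub>1\<close> and \<open>S\<^sup>-\<^sup>1(t\<^sub>2)\<close> are dual bases for \<open>\<phi>\<close>.\<close>

lemma left_act_phi_Si: "left_act (\<lambda>z. \<phi> (x * Si z)) t = x"
proof (rule nondegenerate_left)
  fix y
  let ?h = "\<lambda>z. \<phi> (x * Si z)"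
  have h: "?h \<in> dual" by (intro dual_Si dual_intros)
  have "\<phi> (left_act ?h t * y) = ((\<lambda>z. \<phi> (z * y)) \<star> ?h) t"
    by (rule apply_left_act[OF phi_right_dual])
  \<comment> \<open>The same convolution at \<open>t\<close> is now read as a right action, where
    \<open>S_eq\<close> recognizes \<open>S y\<close>.\<close>
  also have "\<dots> = ?h (S y)"
    by (simp add: S_eq apply_right_act[OF h])
  finally show "\<phi> (left_act ?h t * y) = \<phi> (x * y)"
    by (simp add: Si_S)
qed

text \<open>The forms \<open>\<phi> \<circ> S\<close> and \<open>\<phi> \<circ> Si\<close> are
  written as \<open>\<phi> (c * _)\<close> and \<open>\<phi> (_ * w)\<close>. As \<open>S\<close>
  and \<open>Si\<close> cancel, \<open>c\<close> and \<open>Si w\<close> are mutually inverse, and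
  the dual bases identify \<open>c\<close> with \<open>a\<close>.\<close>

lemma
  shows phi_S: "\<phi> (S x) = \<phi> (a * x)"
    and left_act_phi_right: "left_act (\<lambda>y. \<phi> (y * x)) t = a * Si x"
    and a_invertible: "\<exists>u. a * u = 1 \<and> u * a = 1"
proof -
  obtain w where w: "\<phi> (Si z) = \<phi> (z * w)" for z
    using dual_phi_right[OF dual_Si[OF phi_dual]] by metis
  obtain c where c: "\<phi> (S z) = \<phi> (c * z)" for z
    using dual_phi_left[OF dual_S[OF phi_dual]] by metis
  have "\<phi> (c * Si w * y) = \<phi> (1 * y)" for y
    by (metis (no_types) Si_S Si_mult c S_Si mult.assoc mult_1 w)
  then have cw: "c * Si w = 1" by (rule nondegenerate_left)
  have "\<phi> (y * (S c * w)) = \<phi> (y * 1)" for y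
    by (metis (no_types) S_mult Si_S c S_Si mult.assoc mult_1_right w)
  then have Scw: "S c * w = 1" by (rule nondegenerate_right)
  have left_act: "left_act (\<lambda>y. \<phi> (y * (x * w))) t = Si x" for x
    using left_act_phi_Si[of "Si x"] by (simp add: w Si_mult[symmetric] mult.assoc)
  \<comment> \<open>At \<open>x = S c\<close> the acting form is \<open>\<phi>\<close> itself,
    because \<open>S c * w = 1\<close>.\<close>
  have a: "a = c"
    using left_act[of "S c"] by (simp add: modular_element_def Scw Si_S)
  have "w * S c = 1" using cw by (metis S_Si S_mult S_1)
  then have "left_act (\<lambda>y. \<phi> (y * x)) t = Si (x * S c)"
    using left_act[of "x * S c"] by (simp add: mult.assoc Scw)
  then show "left_act (\<lambda>y. \<phi> (y * x)) t = a * Si x"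
    by (simp add: Si_mult Si_S a)
  show "\<phi> (S x) = \<phi> (a * x)" by (simp add: a c)
  have "Si w * c = 1" using Scw by (metis Si_S Si_mult Si_1)
  with cw a show "\<exists>u. a * u = 1 \<and> u * a = 1" by blast
qed

text \<open>For \<open>f\<close> written as \<open>\<phi> (_ * x)\<close>, the left action on
  \<open>t\<close> gives \<open>a * Si x\<close> and the right action gives \<open>S x\<close>. This
  relates the two tensor factors of \<open>\<Delta> t\<close>.\<close>

lemma left_act_t:
  assumes "f \<in> dual"
  shows "left_act f t = a * Si (Si (right_act t f))"
proof -
  obtain x where f: "f = (\<lambda>y. \<phi> (y * x))" using dual_phi_right assms by blast
  show ?thesis unfolding f left_act_phi_right S_eq[symmetric] Si_S ..
qed

lemma left_act_t_inject:
  assumes "f \<in> dual" "g \<in> dual" "left_act f t = left_act g t"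
  shows "f = g"
proof (rule right_act_t_inject)
  obtain u where u: "u * a = 1" using a_invertible by blast
  have "u * (a * Si (Si (right_act t f))) = u * (a * Si (Si (right_act t g)))"
    using assms by (simp add: left_act_t)
  then have "Si (Si (right_act t f)) = Si (Si (right_act t g))"
    by (simp add: mult.assoc[symmetric] u)
  then show "right_act t f = right_act t g" using S_Si by metis
qed fact+

section \<open>The antipode on the modular element and on the integral\<close>

lemma Si_right_act:
  assumes "f \<in> dual"
  shows "Si (right_act x f) = left_act (\<lambda>z. f (S z)) (Si x)"
  by (rule S_eqD) (simp add: S_left_act dual_S assms S_Si)

lemma Si_left_act:
  assumes "f \<in> dual"
  shows "Si (left_act f x) = right_act (Si x) (\<lambda>z. f (S z))"
  by (rule S_eqD) (simp add: S_right_act dual_S assms S_Si)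

text \<open>The dual basis expansion of 1 is rewritten, by exchanging left and right actions, as a
  multiple of \<open>a * Si a\<close>; the counit shows that the factor is 1.\<close>

lemma phi_Si_t: "\<phi> (Si t) = 1"
  and a_mult_Si_a: "a * Si a = 1"
proof -
  have "1 = left_act (\<lambda>z. \<phi> (Si z)) t"
    using left_act_phi_Si[of 1] by simp
  also have "\<dots> = a * Si (left_act \<phi> (Si t))"
    by (simp add: left_act_t dual_intros Si_right_act S_Si Si_S)
  also have "\<dots> = scale (\<phi> (Si t)) (a * Si a)"
    by (simp add: left_act_phi Si_scale scale_mult_right)
  finally have 1: "scale (\<phi> (Si t)) (a * Si a) = 1" by simp
  then have "\<epsilon> (scale (\<phi> (Si t)) (a * Si a)) = 1" by (simp add: counit_one)
  then show "\<phi> (Si t) = 1"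
    by (simp add: dual_scale[OF counit_dual] counit_mult counit_Si counit_a)
  with 1 show "a * Si a = 1" by simp
qed

lemma Si_a_mult_a: "Si a * a = 1"
  using a_invertible inverse_element_unique[OF _ a_mult_Si_a] by metis

text \<open>Both \<open>S a\<close> and \<open>Si a\<close> are inverses of \<open>a\<close>, hence
  equal.\<close>

lemma S_S_a: "S (S a) = a"
proof -
  have "a * S a = 1" using arg_cong[OF a_mult_Si_a, of S] by (simp add: S_mult S_Si S_1)
  then have "S a = Si a" using Si_a_mult_a inverse_element_unique by metis
  then show ?thesis by (simp add: S_Si)
qed

lemma mult_inverse_a: "mult_inverse a = Si a"
  unfolding mult_inverse_def using a_mult_Si_a Si_a_mult_a
  by (intro the_equality conjI) (auto dest: inverse_element_unique)

text \<open>In the dual basis expansion of \<open>Si t\<close> the acting form is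
  \<open>\<phi> (Si (_ * t))\<close>, which \<open>mult_t\<close> turns into
  \<open>\<alpha>\<close>.\<close>

lemma Si_t: "Si t = left_act \<alpha> t"
proof -
  have "\<phi> (Si t * Si z) = \<alpha> z" for z
    unfolding Si_mult[symmetric] mult_t
    by (simp add: Si_scale dual_scale[OF phi_dual] phi_Si_t)
  with left_act_phi_Si[of "Si t"] show ?thesis by simp
qed

text \<open>Some such \<open>f\<close> exists by \<open>cofrobenius\<close>. The formulas are first
  derived for this unknown \<open>f\<close>, because they are what identifies it with
  \<open>\<alpha>\<close>.\<close>

lemma S_t_right_act:
  assumes "f \<in> dual" "S t = right_act t f"
  shows "right_act t (\<lambda>y. \<phi> (x * y)) = Si (right_act x f)" and "f = \<alpha>"
    and "(\<lambda>z. f (S z)) \<star> \<alpha> = \<epsilon>"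
proof -
  have "t = left_act (\<lambda>z. f (S z)) (left_act \<alpha> t)"
    using assms by (metis Si_right_act Si_S Si_t)
  then have "left_act ((\<lambda>z. f (S z)) \<star> \<alpha>) t = left_act \<epsilon> t"
    by (simp add: left_act_left_act dual_intros assms counit_right)
  then show inv: "(\<lambda>z. f (S z)) \<star> \<alpha> = \<epsilon>"
    by (rule left_act_t_inject[rotated 2]) (intro dual_intros assms)+
  have *: "right_act t (\<lambda>y. \<phi> (x * y)) = Si (right_act x f)" for x
  proof -
    have "Si x = left_act \<alpha> (right_act t (\<lambda>y. \<phi> (x * y)))"
    proof (rule dual_separates)
      fix g assume g: "g \<in> dual"
      \<comment> \<open>The element \<open>x\<close> is expanded in the dual bases, and
        \<open>t\<close> is written as \<open>S (Si t)\<close> so that the antipode can be moved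
        onto the forms.\<close>
      have "g (Si x) = ((\<lambda>z. g (Si z)) \<star> (\<lambda>z. \<phi> (x * Si z))) (S (Si t))"
        unfolding S_Si
        by (subst apply_left_act[symmetric, OF dual_Si[OF g]]) (simp add: left_act_phi_Si)
      also have "\<dots> = ((\<lambda>z. \<phi> (x * z)) \<star> g) (Si t)"
        by (subst convolution_S) (intro dual_intros g dual_Si[OF phi_left_dual] | simp add: Si_S)+
      also have "\<dots> = ((\<lambda>z. \<phi> (x * z)) \<star> g \<star> \<alpha>) t"
        unfolding Si_t by (intro apply_left_act dual_intros g)
      also have "\<dots> = g (left_act \<alpha> (right_act t (\<lambda>y. \<phi> (x * y))))"
        by (simp add: apply_left_act apply_right_act convolution_assoc dual_intros g)
      finally show "g (Si x) = g (left_act \<alpha> (right_act t (\<lambda>y. \<phi> (x * y))))" .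
    qed
    \<comment> \<open>Acting by the left convolution inverse of \<open>\<alpha>\<close> found in
      \<open>inv\<close> cancels \<open>\<alpha>\<close>.\<close>
    then have "left_act (\<lambda>z. f (S z)) (Si x) = right_act t (\<lambda>y. \<phi> (x * y))"
      by (simp add: left_act_left_act dual_intros assms inv counit_right)
    then show ?thesis by (simp add: Si_right_act assms)
  qed
  then show "right_act t (\<lambda>y. \<phi> (x * y)) = Si (right_act x f)" .
  show "f = \<alpha>"
  proof
    fix x
    \<comment> \<open>The counit leaves \<open>\<phi> (x * t)\<close>, which is
      \<open>\<alpha> x\<close>, on the left and \<open>f x\<close> on the right.\<close>
    have "\<epsilon> (right_act t (\<lambda>y. \<phi> (x * y))) = \<epsilon> (Si (right_act x f))" by (simp add: *)
    then show "f x = \<alpha> x"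
      by (simp add: apply_right_act counit_Si counit_dual convolution_counit_right dual_intros
          assms alpha_eq)
  qed
qed


lemma S_t: "S t = right_act t \<alpha>"
proof -
  obtain f where "f \<in> dual" "S t = right_act t f"
    using cofrobenius by blast
  then show ?thesis using S_t_right_act(2) by blast
qed

lemmas right_act_t_phi_left = S_t_right_act(1)[OF alpha_dual S_t]
  and alpha_S_convolution_alpha = S_t_right_act(3)[OF alpha_dual S_t]

text \<open>Applying \<open>S\<close> to \<open>Si_t\<close> makes
  \<open>\<alpha> \<circ> Si\<close> a right convolution inverse of \<open>\<alpha>\<close>; since
  \<open>\<alpha> \<circ> S\<close> is a left inverse, the two agree.\<close>

lemma alpha_S_eq_alpha_Si: "(\<lambda>z. \<alpha> (S z)) = (\<lambda>z. \<alpha> (Si z))"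
  and alpha_convolution_alpha_S: "\<alpha> \<star> (\<lambda>z. \<alpha> (S z)) = \<epsilon>"
proof -
  have "t = right_act (S t) (\<lambda>z. \<alpha> (Si z))"
    using S_left_act[OF alpha_dual, of t] by (simp add: S_Si flip: Si_t)
  with S_t have "right_act t (\<alpha> \<star> (\<lambda>z. \<alpha> (Si z))) = right_act t \<epsilon>"
    by (simp add: right_act_right_act[symmetric] dual_intros counit_left)
  then have inv: "\<alpha> \<star> (\<lambda>z. \<alpha> (Si z)) = \<epsilon>"
    by (rule right_act_t_inject[rotated 2]) (intro dual_intros)+
  show eq: "(\<lambda>z. \<alpha> (S z)) = (\<lambda>z. \<alpha> (Si z))"
    by (rule convolution_inverse_unique[OF _ _ _ alpha_S_convolution_alpha inv]) (intro dual_intros)+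
  show "\<alpha> \<star> (\<lambda>z. \<alpha> (S z)) = \<epsilon>"
    by (simp add: eq inv)
qed

lemma convolution_inverse_alpha: "convolution_inverse \<alpha> = (\<lambda>z. \<alpha> (S z))"
  by (intro convolution_inverse_eq alpha_S_convolution_alpha alpha_convolution_alpha_S dual_intros)

subsection \<open>The Nakayama automorphism and the fourth power of the antipode\<close>

definition nakayama :: "'b \<Rightarrow> 'b"
  where "nakayama x = Si (Si (right_act x \<alpha>))"

text \<open>Both forms take \<open>t\<close> to \<open>Si (right_act x \<alpha>)\<close>: for the
  second one, \<open>S\<close> cancels one of the two \<open>Si\<close> in
  \<open>nakayama\<close>.\<close>

lemma phi_commute: "\<phi> (x * y) = \<phi> (y * nakayama x)"
proof -
  have "(\<lambda>y. \<phi> (x * y)) = (\<lambda>y. \<phi> (y * nakayama x))"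
    by (rule right_act_t_inject)
      (simp_all add: dual_intros S_eq[symmetric] right_act_t_phi_left nakayama_def S_Si)
  then show ?thesis by metis
qed

lemma nakayama_a: "nakayama a = scale (\<alpha> a) a"
proof -
  have "Si (Si a) = a" by (metis S_S_a Si_S)
  then show ?thesis by (simp add: nakayama_def right_act_a alpha_dual Si_scale)
qed

lemma alpha_a_nonzero: "\<alpha> a \<noteq> 0"
  using alpha_mult[of a "Si a"] by (auto simp: a_mult_Si_a alpha_1)

text \<open>The Nakayama automorphism of \<open>\<phi> \<circ> S = \<phi> \<leftharpoonup> a\<close> is computed from both sides of this
  equation.\<close>

lemma nakayama_twisted: "x * a = a * nakayama (Si (nakayama (S x)))"
proof -
  \<comment> \<open>Chosen so that \<open>S ?y = nakayama (S x)\<close>: moving \<open>S x\<close>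
    past \<open>S y\<close> under \<open>\<phi>\<close> then produces
    \<open>S (?y * y)\<close>.\<close>
  let ?y = "Si (nakayama (S x))"
  have "x * nakayama a = nakayama a * nakayama ?y"
  proof (rule nondegenerate_right)
    fix y
    have "\<phi> (y * (x * nakayama a)) = \<phi> (a * (y * x))"
      by (simp add: phi_commute[of a] mult.assoc)
    also have "\<dots> = \<phi> (S x * S y)" by (simp add: phi_S[symmetric] S_mult)
    also have "\<dots> = \<phi> (S (?y * y))" by (simp add: phi_commute[of "S x"] S_mult S_Si)
    also have "\<dots> = \<phi> (?y * (y * nakayama a))"
      by (simp add: phi_S phi_commute[of a] mult.assoc)
    also have "\<dots> = \<phi> (y * (nakayama a * nakayama ?y))"
      by (simp add: phi_commute[of ?y] mult.assoc)
    finally show "\<phi> (y * (x * nakayama a)) = \<phi> (y * (nakayama a * nakayama ?y))" .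
  qed
  \<comment> \<open>\<open>nakayama a\<close> is a nonzero multiple of \<open>a\<close>, so the
    scalar cancels on both sides.\<close>
  then show ?thesis
    by (simp add: nakayama_a scale_mult_left scale_mult_right alpha_a_nonzero)
qed

text \<open>The inner action changes sides when \<open>S\<close> is pulled out, which turns
  \<open>\<alpha>\<close> into \<open>\<alpha> \<circ> S\<close>; the outer one passes through
  \<open>Si \<circ> Si\<close> because
  \<open>\<alpha> \<circ> S \<circ> S = \<alpha>\<close>.\<close>

lemma nakayama_twisted_eq:
  "nakayama (Si (nakayama (S x))) =
    Si (Si (Si (Si (left_act (\<lambda>z. \<alpha> (S z)) (right_act x \<alpha>)))))"
proof -
  have alpha_S_S: "\<alpha> (S (S z)) = \<alpha> z" for z
    using fun_cong[OF alpha_S_eq_alpha_Si, of "S z"] by (simp add: Si_S)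
  have "right_act (S x) \<alpha> = S (left_act (\<lambda>z. \<alpha> (S z)) x)"
    by (simp add: S_left_act dual_intros S_Si)
  then have "Si (nakayama (S x)) = Si (Si (left_act (\<lambda>z. \<alpha> (S z)) x))"
    by (simp add: nakayama_def Si_S)
  moreover have "right_act (Si (Si z)) \<alpha> = Si (Si (right_act z \<alpha>))" for z
    by (simp add: Si_right_act Si_left_act dual_intros alpha_S_S)
  ultimately show ?thesis
    by (simp add: nakayama_def left_act_right_act dual_intros)
qed

section \<open>Radford's formula\<close>

lemma radford:
  "(S ^^ 4) x = a * left_act (convolution_inverse \<alpha>) (right_act x \<alpha>) * mult_inverse a"
proof -
  let ?m = "left_act (\<lambda>z. \<alpha> (S z)) (right_act x \<alpha>)"
  have S4: "(S ^^ 4) z = S (S (S (S z)))" for z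
    by (simp add: eval_nat_numeral)
  \<comment> \<open>The fourth power of \<open>S\<close> preserves products, fixes \<open>a\<close>
    and undoes the four \<open>Si\<close>.\<close>
  have "(S ^^ 4) (x * a) = (S ^^ 4) (a * Si (Si (Si (Si ?m))))"
    by (simp add: nakayama_twisted nakayama_twisted_eq)
  then have "(S ^^ 4) x * a = a * ?m"
    by (simp add: S4 S_mult S_S_a S_Si)
  then have "(S ^^ 4) x * (a * Si a) = a * ?m * Si a"
    by (simp add: mult.assoc[symmetric])
  then show ?thesis
    by (simp add: convolution_inverse_alpha mult_inverse_a a_mult_Si_a)
qed

text \<open>Against a form \<open>f\<close>, conjugation by \<open>a\<close> is absorbed into the
  middle form \<open>?h\<close>; what remains is a triple convolution, which
  \<open>lift3_comult_left\<close> reads as a Sweedler sum.\<close>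

lemma radford_sweedler:
  "(S ^^ 4) x =
    lift3 scale (\<lambda>x1 x2 x3. scale (\<alpha> x1 * convolution_inverse \<alpha> x3) (a * x2 * mult_inverse a))
      (comult_left x)"
proof (rule dual_separates)
  fix f assume f: "f \<in> dual"
  let ?\<beta> = "convolution_inverse \<alpha>" and ?h = "\<lambda>z. f (a * z * mult_inverse a)"
  have \<beta>: "?\<beta> \<in> dual" by (simp add: convolution_inverse_alpha dual_intros)
  have h: "?h \<in> dual"
    using dual_mult_left[OF dual_mult_right[OF f]] by simp
  have "f ((S ^^ 4) x) = ?h (left_act ?\<beta> (right_act x \<alpha>))"
    by (simp add: radford)
  also have "\<dots> = (\<alpha> \<star> ?h \<star> ?\<beta>) x"
    by (simp only: apply_left_act[OF h] apply_right_act[OF convolution_dual[OF h \<beta>]]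
        convolution_assoc[OF alpha_dual h \<beta>])
  also have "\<dots> = lift3 (*) (\<lambda>u v w. \<alpha> u * ?h v * ?\<beta> w) (comult_left x)"
    by (rule lift3_comult_left[OF alpha_dual h \<beta>, symmetric])
  finally show "f ((S ^^ 4) x) = f (lift3 scale
      (\<lambda>x1 x2 x3. scale (\<alpha> x1 * ?\<beta> x3) (a * x2 * mult_inverse a)) (comult_left x))"
    by (simp add: dual_lift3[OF f] dual_scale[OF f] mult_ac)
qed

lemma radford_unimodular:
  assumes "\<alpha> = \<epsilon>" "a = 1"
  shows "S ^^ 4 = id"
proof
  fix x
  have "convolution_inverse \<alpha> = \<epsilon>"
    using convolution_inverse_alpha by (simp add: assms counit_S)
  moreover have "mult_inverse a = 1"
    using mult_inverse_a by (simp add: assms Si_1)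
  ultimately show "(S ^^ 4) x = id x"
    by (simp add: radford counit_left counit_right assms)
qed

end

theorem mainTheorem1:
  fixes scale :: "'k::field \<Rightarrow> 'h::ring_1 \<Rightarrow> 'h"
    and \<Delta> :: "'h \<Rightarrow> ('h \<times> 'h \<Rightarrow>\<^sub>0 'k) set"
    and \<epsilon> :: "'h \<Rightarrow> 'k" and t :: 'h and \<phi> :: "'h \<Rightarrow> 'k"
    and S :: "'h \<Rightarrow> 'h" and a a_inv :: 'h and \<alpha> \<alpha>_inv :: "'h \<Rightarrow> 'k"
  assumes biFrobenius: "bifrobenius_algebra scale \<Delta> \<epsilon> t \<phi>"
    and S: "S = prebifrobenius_algebra.antipode scale \<Delta> t \<phi>"
    and a: "a = prebifrobenius_algebra.modular_element scale \<Delta> t \<phi>"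
    and \<alpha>: "\<alpha> = prebifrobenius_algebra.modular_function t \<phi>"
    and a_inv: "a_inv = mult_inverse a"
    and \<alpha>_inv: "\<alpha>_inv = precoalgebra.convolution_inverse scale \<Delta> \<epsilon> \<alpha>"
  shows "(\<forall>x. (S ^^ 4) x =
            a * precoalgebra.left_act scale \<Delta> \<alpha>_inv (precoalgebra.right_act scale \<Delta> x \<alpha>) * a_inv) \<and>
         (\<forall>x. (S ^^ 4) x =
            vector_space.lift3 scale
              (\<lambda>x1 x2 x3. scale (\<alpha> x1 * \<alpha>_inv x3) (a * x2 * a_inv))
              (precoalgebra.comult_left scale \<Delta> x)) \<and>
         (\<alpha> = \<epsilon> \<and> a = 1 \<longrightarrow> S ^^ 4 = id)"
proof -
  interpret bifrobenius_algebra scale \<Delta> \<epsilon> t \<phi> by (rule biFrobenius)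
  show ?thesis
    unfolding S a \<alpha> a_inv \<alpha>_inv
    using radford radford_sweedler radford_unimodular by blast
qed

end
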